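(* Let $P_n$ denote the path on $n$ vertices. Then $\chi_\rho''(P_3)=4$; $\chi_\rho''(P_n)=5$ for $n\in\{4,5\}$; $\chi_\rho''(P_n)=6$ for $n\in\{6,7\}$; $\chi_\rho''(P_n)=7$ for $n\in\{8,9\}$. Moreover, for every $n\geq 10$, $\chi_\rho''(P_n)\in\{7,8\}$.
   Context: All graphs are simple, finite and undirected. The total graph $T(G)$ of a graph $G$ has vertex set $V(G)\cup E(G)$, where two elements are adjacent if they are adjacent vertices of $G$, incident edges of $G$ (sharing an endpoint), or a vertex and an edge of $G$ having that vertex as an endpoint. A packing total coloring of $G$ is a map $c:V(G)\cup E(G)\to\{1,2,\dots\}$ such that for any two distinct elements $A,B\in V(G)\cup E(G)$ with $c(A)=c(B)=i$, the distance between $A$ and $B$ in $T(G)$ is greater than $i$. The packing total chromatic number $\chi_\rho''(G)$ is the smallest $k$ such that $G$ has a packing total coloring with colors from $\{1,\dots,k\}$. *)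

theory Defs
  imports "HOL-Library.Extended_Nat"
begin

text \<open>Edges are represented by the sets of their endpoints. Finiteness and simplicity are not
  built into the type; they are expressed by \<open>simple_graph\<close>.\<close>

record 'a graph =
  verts :: "'a set"
  edges :: "'a set set"

definition simple_graph :: "'a graph \<Rightarrow> bool" where
  "simple_graph G \<longleftrightarrow>
     finite (verts G) \<and> (\<forall>e\<in>edges G. e \<subseteq> verts G \<and> card e = 2)"

definition walk :: "'a graph \<Rightarrow> 'a list \<Rightarrow> bool" where
  "walk G p \<longleftrightarrow>
     p \<noteq> [] \<and> set p \<subseteq> verts G \<and> successively (\<lambda>u v. {u, v} \<in> edges G) p"

text \<open>The length of a walk is its number of edges. The infimum over the empty set is \<open>\<infinity>\<close>,
  so vertices in different components are at infinite distance.\<close>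

definition graph_dist :: "'a graph \<Rightarrow> 'a \<Rightarrow> 'a \<Rightarrow> enat" where
  "graph_dist G u v =
     (INF p\<in>{p. walk G p \<and> hd p = u \<and> last p = v}. enat (length p - 1))"

text \<open>In the total graph, \<open>Inl v\<close> is the vertex \<open>v\<close> of \<open>G\<close> and \<open>Inr e\<close> is the edge \<open>e\<close> of \<open>G\<close>.\<close>

definition total_graph :: "'a graph \<Rightarrow> ('a + 'a set) graph" where
  "total_graph G =
     \<lparr> verts = Inl ` verts G \<union> Inr ` edges G,
       edges = {{Inl u, Inl v} | u v. {u, v} \<in> edges G}
             \<union> {{Inr e, Inr f} | e f. e \<in> edges G \<and> f \<in> edges G \<and> e \<noteq> f \<and> e \<inter> f \<noteq> {}}
             \<union> {{Inl v, Inr e} | v e. e \<in> edges G \<and> v \<in> e} \<rparr>"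

definition packing_total_coloring :: "'a graph \<Rightarrow> ('a + 'a set \<Rightarrow> nat) \<Rightarrow> bool" where
  "packing_total_coloring G c \<longleftrightarrow>
     (\<forall>A\<in>verts (total_graph G). 1 \<le> c A) \<and>
     (\<forall>A\<in>verts (total_graph G). \<forall>B\<in>verts (total_graph G).
        A \<noteq> B \<and> c A = c B \<longrightarrow> enat (c A) < graph_dist (total_graph G) A B)"

definition packing_total_chromatic_number :: "'a graph \<Rightarrow> nat" where
  "packing_total_chromatic_number G =
     (LEAST k. \<exists>c. packing_total_coloring G c \<and> c ` verts (total_graph G) \<subseteq> {1..k})"

definition path_graph :: "nat \<Rightarrow> nat graph" where
  "path_graph n = \<lparr> verts = {1..n}, edges = {{i, i + 1} | i. 1 \<le> i \<and> i < n} \<rparr>"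

lemma simple_graph_path_graph: "simple_graph (path_graph n)"
  by (auto simp: simple_graph_def path_graph_def)

lemma simple_graph_total_graph:
  assumes "simple_graph G"
  shows "simple_graph (total_graph G)"
proof -
  have "edges G \<subseteq> Pow (verts G)" "finite (verts G)"
    using assms by (auto simp: simple_graph_def)
  then have fin: "finite (verts G)" "finite (edges G)"
    by (auto intro: finite_subset)
  have ne: "u \<noteq> v" if "{u, v} \<in> edges G" for u v
  proof
    assume "u = v"
    with that have "card {v} = 2" using assms by (auto simp: simple_graph_def)
    then show False by simp
  qed
  show ?thesis
    using assms fin ne by (auto simp: simple_graph_def total_graph_def card_insert_if)
qed

text \<open>The set of admissible numbers of colours is nonempty, so the \<open>LEAST\<close> in the definition of
  the packing total chromatic number is attained.\<close>

lemma packing_total_coloring_exists: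
  assumes "simple_graph G"
  shows "\<exists>k c. packing_total_coloring G c \<and> c ` verts (total_graph G) \<subseteq> {1..k}"
proof -
  have "finite (verts (total_graph G))"
    using simple_graph_total_graph[OF assms] by (simp add: simple_graph_def)
  then obtain f :: "_ \<Rightarrow> nat" and n where f: "inj_on f (verts (total_graph G))"
      "f ` verts (total_graph G) = {i. i < n}"
    using finite_imp_inj_to_nat_seg by metis
  have "packing_total_coloring G (Suc \<circ> f)"
    using f(1) by (auto simp: packing_total_coloring_def inj_on_def)
  moreover have "(Suc \<circ> f) ` verts (total_graph G) \<subseteq> {1..n}"
    using f(2) by (auto simp: Suc_le_eq)
  ultimately show ?thesis by blast
qed

end

theory Submission
  imports Defs
begin

text \<open>Listing vertices and edges of \<open>P\<^sub>n\<close> alternately along the path turns its total graph into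
  the square of a path on \<open>2n - 1\<close> vertices, where positions \<open>i\<close> and \<open>j\<close> have distance
  \<open>\<lceil>\<bar>i - j\<bar> / 2\<rceil>\<close>. So \<open>k\<close> colours suffice iff there is a word of length \<open>2n - 1\<close> over \<open>{1..k}\<close>
  in which any two occurrences of a letter \<open>c\<close> are more than \<open>2c\<close> positions apart. Exhaustive search
  excludes the parameters \<open>(2n - 1, k)\<close> equal to \<open>(5, 3)\<close>, \<open>(7, 4)\<close>, \<open>(11, 5)\<close> and \<open>(15, 6)\<close>,
  explicit words settle the short paths, and a word that is admissible cyclically yields
  8-colourings of all paths.\<close>

section \<open>The total graph of a path\<close>

definition path_elem :: "nat \<Rightarrow> nat + nat set" where
  "path_elem k = (if even k then Inl (Suc (k div 2)) else Inr {Suc (k div 2), Suc (Suc (k div 2))})"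

lemma path_elem_even [simp]: "path_elem (2 * a) = Inl (Suc a)"
  by (simp add: path_elem_def)

lemma path_elem_odd [simp]: "path_elem (Suc (2 * a)) = Inr {Suc a, Suc (Suc a)}"
  by (simp add: path_elem_def)

lemma nat_parity_cases: obtains a where "(k::nat) = 2 * a" | a where "k = Suc (2 * a)"
  by (cases "even k") (auto elim!: evenE oddE)

lemma path_elem_eq_iff [simp]: "path_elem i = path_elem j \<longleftrightarrow> i = j"
  by (rule nat_parity_cases[of i]; rule nat_parity_cases[of j])
     (auto simp: doubleton_eq_iff Suc_double_not_eq_double double_not_eq_Suc_double)

lemma edges_path_graph_iff:
  "{u, v} \<in> edges (path_graph n) \<longleftrightarrow>
     (1 \<le> u \<and> u < n \<and> v = Suc u) \<or> (1 \<le> v \<and> v < n \<and> u = Suc v)"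
  by (auto simp: path_graph_def doubleton_eq_iff)

text \<open>The truncated subtraction is right even for \<open>n = 0\<close>, where both sides are
  empty.\<close>

lemma verts_total_graph_path:
  "verts (total_graph (path_graph n)) = path_elem ` {..<2 * n - 1}"
proof (intro equalityI subsetI)
  fix A assume "A \<in> verts (total_graph (path_graph n))"
  then consider u where "A = Inl u" "1 \<le> u" "u \<le> n"
    | u where "A = Inr {u, Suc u}" "1 \<le> u" "u < n"
    by (auto simp: total_graph_def path_graph_def)
  then show "A \<in> path_elem ` {..<2 * n - 1}"
  proof cases
    case 1
    then obtain a where "u = Suc a" by (cases u) auto
    with 1 have "A = path_elem (2 * a)" "2 * a < 2 * n - 1" by simp_all
    then show ?thesis by blast
  next
    case 2
    then obtain a where "u = Suc a" by (cases u) auto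
    with 2 have "A = path_elem (Suc (2 * a))" "Suc (2 * a) < 2 * n - 1" by simp_all
    then show ?thesis by blast
  qed
next
  fix A assume "A \<in> path_elem ` {..<2 * n - 1}"
  then obtain k where k: "A = path_elem k" "k < 2 * n - 1" by blast
  show "A \<in> verts (total_graph (path_graph n))"
  proof (cases k rule: nat_parity_cases)
    case (1 a)
    with k show ?thesis by (simp add: total_graph_def path_graph_def)
  next
    case (2 a)
    with k show ?thesis
      by (simp add: total_graph_def path_graph_def image_iff) (intro exI[of _ "Suc a"], simp)
  qed
qed

lemma total_graph_edge_iffs:
  "{Inl u, Inl v} \<in> edges (total_graph G) \<longleftrightarrow> {u, v} \<in> edges G"
  "{Inl u, Inr e} \<in> edges (total_graph G) \<longleftrightarrow> e \<in> edges G \<and> u \<in> e"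
  "{Inr e, Inl u} \<in> edges (total_graph G) \<longleftrightarrow> e \<in> edges G \<and> u \<in> e"
  "{Inr e, Inr f} \<in> edges (total_graph G) \<longleftrightarrow>
     e \<in> edges G \<and> f \<in> edges G \<and> e \<noteq> f \<and> e \<inter> f \<noteq> {}"
  by (auto simp: total_graph_def doubleton_eq_iff insert_commute)

text \<open>Positions of equal parity at gap 2 are adjacent vertices or incident edges, and
  positions of opposite parity at gap 1 are a vertex and an edge containing it.\<close>

lemma total_graph_path_edge_iff:
  assumes "i < 2 * n - 1" "j < 2 * n - 1"
  shows "{path_elem i, path_elem j} \<in> edges (total_graph (path_graph n)) \<longleftrightarrow>
           i \<noteq> j \<and> \<bar>int i - int j\<bar> \<le> 2"
proof -
  have eq: "{Suc a, Suc (Suc a)} = {Suc b, Suc (Suc b)} \<longleftrightarrow> a = b" for a b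
    by (auto simp: doubleton_eq_iff)
  have disj: "{Suc a, Suc (Suc a)} \<inter> {Suc b, Suc (Suc b)} = {} \<longleftrightarrow>
      a \<noteq> b \<and> a \<noteq> Suc b \<and> b \<noteq> Suc a" for a b
    by auto
  have "{path_elem i, path_elem j} \<in> edges (total_graph (path_graph n)) \<longleftrightarrow>
           i \<noteq> j \<and> i \<le> j + 2 \<and> j \<le> i + 2"
  proof (cases i rule: nat_parity_cases; cases j rule: nat_parity_cases)
    fix a b assume ij: "i = 2 * a" "j = 2 * b"
    then have "a < n" "b < n" "i \<le> j + 2 \<longleftrightarrow> a \<le> Suc b" "j \<le> i + 2 \<longleftrightarrow> b \<le> Suc a"
      using assms by linarith+
    with ij show ?thesis
      by (auto simp: total_graph_edge_iffs edges_path_graph_iff)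
  next
    fix a b assume ij: "i = 2 * a" "j = Suc (2 * b)"
    \<comment> \<open>Because the parities differ, the bounds leave only \<open>a = b\<close> and
      \<open>a = Suc b\<close>: the vertex \<open>Suc a\<close> is one of the two endpoints of the
      edge.\<close>
    then have "a < n" "Suc b < n" "i \<noteq> j" "i \<le> j + 2 \<longleftrightarrow> a \<le> Suc b" "j \<le> i + 2 \<longleftrightarrow> b \<le> a"
      using assms by (linarith | presburger)+
    with ij show ?thesis
      by (auto simp: total_graph_edge_iffs edges_path_graph_iff)
  next
    fix a b assume ij: "i = Suc (2 * a)" "j = 2 * b"
    then have "Suc a < n" "b < n" "i \<noteq> j" "i \<le> j + 2 \<longleftrightarrow> a \<le> b" "j \<le> i + 2 \<longleftrightarrow> b \<le> Suc a"
      using assms by (linarith | presburger)+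
    with ij show ?thesis
      by (auto simp: total_graph_edge_iffs edges_path_graph_iff)
  next
    fix a b assume ij: "i = Suc (2 * a)" "j = Suc (2 * b)"
    then have "Suc a < n" "Suc b < n" "i \<le> j + 2 \<longleftrightarrow> a \<le> Suc b" "j \<le> i + 2 \<longleftrightarrow> b \<le> Suc a"
      using assms by linarith+
    with ij show ?thesis
      by (auto simp: total_graph_edge_iffs edges_path_graph_iff eq disj)
  qed
  also have "(i \<le> j + 2 \<and> j \<le> i + 2) \<longleftrightarrow> \<bar>int i - int j\<bar> \<le> 2"
    by linarith
  finally show ?thesis .
qed

text \<open>Lower bound on distances: each step of a walk moves the position by at most 2.\<close>

lemma walk_total_path_length:
  assumes "walk (total_graph (path_graph n)) p" "hd p = path_elem i" "last p = path_elem j"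
  shows "\<bar>int i - int j\<bar> \<le> 2 * int (length p - 1)"
  using assms
proof (induction p arbitrary: i)
  case Nil
  then show ?case by (simp add: walk_def)
next
  case (Cons A p)
  show ?case
  proof (cases p)
    case Nil
    with Cons.prems show ?thesis by simp
  next
    case (Cons B q)
    have A: "A = path_elem i" and "B \<in> path_elem ` {..<2 * n - 1}" "A \<in> path_elem ` {..<2 * n - 1}"
      using Cons.prems by (auto simp: walk_def Cons verts_total_graph_path)
    then obtain m where m: "B = path_elem m" "m < 2 * n - 1" "i < 2 * n - 1" by auto
    have "\<bar>int i - int m\<bar> \<le> 2"
      using Cons.prems m A total_graph_path_edge_iff[of i n m] by (auto simp: walk_def Cons)
    moreover have "\<bar>int m - int j\<bar> \<le> 2 * int (length p - 1)"
      by (rule Cons.IH) (use Cons.prems m in \<open>auto simp: walk_def Cons\<close>)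
    ultimately show ?thesis by (simp add: Cons)
  qed
qed

lemma ex_walk_total_path:
  assumes "i < 2 * n - 1" "j < 2 * n - 1" "\<bar>int i - int j\<bar> \<le> 2 * int m"
  shows "\<exists>p. walk (total_graph (path_graph n)) p \<and> hd p = path_elem i \<and> last p = path_elem j \<and>
             length p \<le> Suc m"
  using assms
proof (induction m arbitrary: i)
  case 0
  then show ?case
    by (intro exI[of _ "[path_elem i]"]) (auto simp: walk_def verts_total_graph_path)
next
  case (Suc m)
  show ?case
  proof (cases "i = j")
    case True
    with Suc.prems show ?thesis
      by (intro exI[of _ "[path_elem i]"]) (auto simp: walk_def verts_total_graph_path)
  next
    case False
    \<comment> \<open>The greedy walk jumps two positions towards \<open>j\<close> without
      overshooting. If \<open>i - 2\<close> is truncated to 0, the maximum with \<open>j\<close> is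
      still correct.\<close>
    define l where "l = (if i < j then min (i + 2) j else max (i - 2) j)"
    have l: "l < 2 * n - 1" "i \<noteq> l" "\<bar>int i - int l\<bar> \<le> 2" "\<bar>int l - int j\<bar> \<le> 2 * int m"
      using Suc.prems False by (auto simp: l_def)
    obtain p where p: "walk (total_graph (path_graph n)) p" "hd p = path_elem l"
        "last p = path_elem j" "length p \<le> Suc m"
      using Suc.IH[OF l(1) Suc.prems(2) l(4)] by blast
    have "{path_elem i, path_elem l} \<in> edges (total_graph (path_graph n))"
      using l Suc.prems by (simp add: total_graph_path_edge_iff)
    with p Suc.prems have "walk (total_graph (path_graph n)) (path_elem i # p)"
      by (auto simp: walk_def successively_Cons verts_total_graph_path)
    with p show ?thesis
      by (intro exI[of _ "path_elem i # p"]) (auto simp: walk_def)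
  qed
qed

text \<open>Comparing with \<open>m\<close> avoids the ceiling in the distance formula and yields
  directly the inequality that a packing coloring demands.\<close>

lemma less_graph_dist_total_path_iff:
  assumes "i < 2 * n - 1" "j < 2 * n - 1"
  shows "enat m < graph_dist (total_graph (path_graph n)) (path_elem i) (path_elem j) \<longleftrightarrow>
           2 * int m < \<bar>int i - int j\<bar>"
proof
  assume less: "enat m < graph_dist (total_graph (path_graph n)) (path_elem i) (path_elem j)"
  show "2 * int m < \<bar>int i - int j\<bar>"
  proof (rule ccontr)
    assume "\<not> ?thesis"
    then obtain p where p: "walk (total_graph (path_graph n)) p" "hd p = path_elem i"
        "last p = path_elem j" "length p \<le> Suc m"
      using ex_walk_total_path[OF assms, of m] by auto
    have "graph_dist (total_graph (path_graph n)) (path_elem i) (path_elem j) \<le> enat (length p - 1)"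
      unfolding graph_dist_def by (rule INF_lower) (use p in auto)
    also have "\<dots> \<le> enat m" using p(4) by simp
    finally show False using less by simp
  qed
next
  assume less: "2 * int m < \<bar>int i - int j\<bar>"
  \<comment> \<open>A strict lower bound need not pass to an infimum in general; the bound by the
    successor does.\<close>
  have "enat (Suc m) \<le> graph_dist (total_graph (path_graph n)) (path_elem i) (path_elem j)"
    unfolding graph_dist_def
  proof (rule INF_greatest)
    fix p assume "p \<in> {p. walk (total_graph (path_graph n)) p \<and> hd p = path_elem i \<and>
      last p = path_elem j}"
    then have "\<bar>int i - int j\<bar> \<le> 2 * int (length p - 1)"
      using walk_total_path_length by blast
    with less show "enat (Suc m) \<le> enat (length p - 1)" by simp
  qed
  then show "enat m < graph_dist (total_graph (path_graph n)) (path_elem i) (path_elem j)"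
    by (metis Suc_ile_eq)
qed

section \<open>Packing words\<close>

text \<open>Only pairs with \<open>i < j\<close> are compared, so that \<open>j - i\<close> is the
  true gap.\<close>

definition packing_word :: "nat \<Rightarrow> nat \<Rightarrow> (nat \<Rightarrow> nat) \<Rightarrow> bool" where
  "packing_word L k f \<longleftrightarrow>
     (\<forall>i<L. f i \<in> {1..k}) \<and> (\<forall>j<L. \<forall>i<j. f i = f j \<longrightarrow> 2 * f i < j - i)"

lemma packing_word_mono:
  assumes "packing_word L k f" "L' \<le> L" "k \<le> k'"
  shows "packing_word L' k' f"
  unfolding packing_word_def
proof (intro conjI allI impI)
  fix i assume "i < L'"
  with assms(2) have "i < L" by simp
  with assms(1) have "f i \<in> {1..k}" unfolding packing_word_def by blast
  with assms(3) show "f i \<in> {1..k'}" by simp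
next
  fix i j assume ij: "j < L'" "i < j" "f i = f j"
  with assms(2) have "j < L" by simp
  with ij assms(1) show "2 * f i < j - i" unfolding packing_word_def by blast
qed

lemma packing_total_coloring_path_iff:
  "packing_total_coloring (path_graph n) c \<and> c ` verts (total_graph (path_graph n)) \<subseteq> {1..k} \<longleftrightarrow>
     packing_word (2 * n - 1) k (c \<circ> path_elem)"
proof -
  define N where "N = 2 * n - 1"
  have ball: "(\<forall>A\<in>path_elem ` {..<N}. Q A) \<longleftrightarrow> (\<forall>i<N. Q (path_elem i))" for Q
    by auto
  have dist: "enat m < graph_dist (total_graph (path_graph n)) (path_elem i) (path_elem j) \<longleftrightarrow>
      2 * int m < \<bar>int i - int j\<bar>" if "i < N" "j < N" for i j m
    using less_graph_dist_total_path_iff that by (simp add: N_def)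
  have "packing_total_coloring (path_graph n) c \<longleftrightarrow>
     (\<forall>i<N. 1 \<le> c (path_elem i)) \<and>
     (\<forall>i<N. \<forall>j<N. i \<noteq> j \<and> c (path_elem i) = c (path_elem j) \<longrightarrow>
        2 * int (c (path_elem i)) < \<bar>int i - int j\<bar>)"
    unfolding packing_total_coloring_def verts_total_graph_path N_def[symmetric] ball path_elem_eq_iff
    by (simp only: dist cong: imp_cong)
  also have "(\<forall>i<N. \<forall>j<N. i \<noteq> j \<and> c (path_elem i) = c (path_elem j) \<longrightarrow>
        2 * int (c (path_elem i)) < \<bar>int i - int j\<bar>) \<longleftrightarrow>
      (\<forall>j<N. \<forall>i<j. c (path_elem i) = c (path_elem j) \<longrightarrow> 2 * c (path_elem i) < j - i)"
    (is "?L \<longleftrightarrow> ?R")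
  proof
    assume L: ?L
    show ?R
    proof (intro allI impI)
      fix i j assume ij: "j < N" "i < j" "c (path_elem i) = c (path_elem j)"
      then have "2 * int (c (path_elem i)) < \<bar>int i - int j\<bar>"
        by (intro L[rule_format]) simp_all
      with ij(2) show "2 * c (path_elem i) < j - i" by linarith
    qed
  next
    assume R: ?R
    show ?L
    proof (intro allI impI)
      fix i j assume ij: "i < N" "j < N" "i \<noteq> j \<and> c (path_elem i) = c (path_elem j)"
      then consider "i < j" | "j < i" by linarith
      then show "2 * int (c (path_elem i)) < \<bar>int i - int j\<bar>"
      proof cases
        case 1
        with ij have "2 * c (path_elem i) < j - i"
          by (intro R[rule_format]) simp_all
        then show ?thesis by linarith
      next
        case 2
        with ij have "2 * c (path_elem j) < i - j"
          by (intro R[rule_format]) simp_all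
        with ij(3) show ?thesis by linarith
      qed
    qed
  qed
  finally have "packing_total_coloring (path_graph n) c \<longleftrightarrow> (\<forall>i<N. 1 \<le> c (path_elem i)) \<and> ?R" .
  moreover have "c ` verts (total_graph (path_graph n)) \<subseteq> {1..k} \<longleftrightarrow>
      (\<forall>i<N. c (path_elem i) \<in> {1..k})"
    unfolding verts_total_graph_path N_def[symmetric] image_subset_iff ball ..
  moreover have "(\<forall>i<N. c (path_elem i) \<in> {1..k}) \<longrightarrow> (\<forall>i<N. 1 \<le> c (path_elem i))"
    by simp
  ultimately show ?thesis
    by (simp only: packing_word_def comp_apply N_def[symmetric]) blast
qed

lemma ex_packing_total_coloring_path_iff:
  "(\<exists>c. packing_total_coloring (path_graph n) c \<and> c ` verts (total_graph (path_graph n)) \<subseteq> {1..k})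
     \<longleftrightarrow> (\<exists>f. packing_word (2 * n - 1) k f)"
proof
  assume "\<exists>f. packing_word (2 * n - 1) k f"
  then obtain f where "packing_word (2 * n - 1) k f" ..
  \<comment> \<open>The word is pulled back along the injective \<open>path_elem\<close>; arbitrary
    values of \<open>inv path_elem\<close> outside its range do not affect the composite.\<close>
  moreover have "f = (f \<circ> inv path_elem) \<circ> path_elem"
    by (simp add: fun_eq_iff inv_f_f inj_def)
  ultimately have "packing_word (2 * n - 1) k ((f \<circ> inv path_elem) \<circ> path_elem)"
    by simp
  then show "\<exists>c. packing_total_coloring (path_graph n) c \<and>
      c ` verts (total_graph (path_graph n)) \<subseteq> {1..k}"
    unfolding packing_total_coloring_path_iff by blast
qed (auto simp only: packing_total_coloring_path_iff)

lemma packing_total_chromatic_number_path_le: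
  assumes "packing_word L k f" "2 * n - 1 \<le> L"
  shows "packing_total_chromatic_number (path_graph n) \<le> k"
  unfolding packing_total_chromatic_number_def ex_packing_total_coloring_path_iff
  using assms packing_word_mono by (blast intro: Least_le)

lemma less_packing_total_chromatic_number_path:
  assumes "\<nexists>f. packing_word L k f" "L \<le> 2 * n - 1"
  shows "k < packing_total_chromatic_number (path_graph n)"
proof -
  \<comment> \<open>Some number of colours works, so the \<open>LEAST\<close> is attained and yields
    an actual word, which can then be truncated to length \<open>L\<close>.\<close>
  have "\<exists>k f. packing_word (2 * n - 1) k f"
    using packing_total_coloring_exists[OF simple_graph_path_graph, of n]
    by (simp only: ex_packing_total_coloring_path_iff)
  then have "\<exists>f. packing_word (2 * n - 1) (packing_total_chromatic_number (path_graph n)) f"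
    unfolding packing_total_chromatic_number_def ex_packing_total_coloring_path_iff
    by (rule LeastI_ex)
  with assms show ?thesis
    by (meson packing_word_mono linorder_not_less)
qed

section \<open>Exhaustive search\<close>

text \<open>Entry \<open>i\<close> of the list \<open>ds\<close> is the number of upcoming positions that are forbidden for the
  colour \<open>i + 1\<close>. The conditional instead of a conjunction keeps evaluation from entering
  branches that are already excluded.\<close>

primrec extendable :: "nat \<Rightarrow> nat list \<Rightarrow> bool" where
  "extendable 0 ds \<longleftrightarrow> True"
| "extendable (Suc m) ds \<longleftrightarrow>
     list_ex (\<lambda>i. if ds ! i = 0 then extendable m ((map (\<lambda>d. d - 1) ds)[i := 2 * Suc i]) else False)
       [0..<length ds]"

text \<open>Soundness of the search: the letters of a word that respects the blocks in
  \<open>ds\<close> select a successful branch. The second assumption is the invariant linking the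
  word to the search state.\<close>

lemma packing_word_extendable:
  assumes "packing_word m (length ds) f"
    and "\<And>i j. i < length ds \<Longrightarrow> j < m \<Longrightarrow> j < ds ! i \<Longrightarrow> f j \<noteq> Suc i"
  shows "extendable m ds"
  using assms
proof (induction m arbitrary: f ds)
  case 0
  then show ?case by simp
next
  case (Suc m)
  \<comment> \<open>Colours start at 1, list indices at 0.\<close>
  define i where "i = f 0 - 1"
  have "f 0 \<in> {1..length ds}"
    using Suc.prems(1) unfolding packing_word_def by blast
  then have i: "f 0 = Suc i" "i < length ds"
    by (auto simp: i_def)
  define ds' where "ds' = (map (\<lambda>d. d - 1) ds)[i := 2 * Suc i]"
  have "ds ! i = 0"
    using Suc.prems(2)[of i 0] i by auto
  moreover have "extendable m ds'"
  proof (rule Suc.IH)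
    show "packing_word m (length ds') (f \<circ> Suc)"
      using Suc.prems(1) unfolding packing_word_def ds'_def comp_apply length_list_update length_map
      by (metis Suc_less_eq diff_Suc_Suc)
    show "(f \<circ> Suc) j \<noteq> Suc l" if "l < length ds'" "j < m" "j < ds' ! l" for l j
    \<comment> \<open>The colour just placed is blocked by the packing condition at position 0;
      every other block is the old one, shifted by one position.\<close>
    proof (cases "l = i")
      case True
      then have "Suc j \<le> 2 * f 0" using that i by (simp add: ds'_def)
      moreover have "f 0 = f (Suc j) \<longrightarrow> 2 * f 0 < Suc j - 0"
        using Suc.prems(1) \<open>j < m\<close> unfolding packing_word_def by blast
      ultimately show ?thesis using True i by auto
    next
      case False
      then show ?thesis
        using that Suc.prems(2)[of l "Suc j"] by (simp add: ds'_def)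
    qed
  qed
  ultimately show ?case
    using i by (auto simp: list_ex_iff ds'_def)
qed

text \<open>In the all-zero state nothing is blocked, so the invariant holds vacuously.\<close>

lemma not_packing_word_if_not_extendable:
  "\<not> extendable L (replicate k 0) \<Longrightarrow> \<nexists>f. packing_word L k f"
  using packing_word_extendable[of L "replicate k 0"] by auto

text \<open>The lengths 5, 7, 11 and 15 are \<open>2 * n - 1\<close> for \<open>n\<close> = 3, 4, 6
  and 8, the first path in each range; longer paths inherit the bound.\<close>

lemma not_packing_word_5_3: "\<nexists>f. packing_word 5 3 f"
  by (rule not_packing_word_if_not_extendable) code_simp

lemma not_packing_word_7_4: "\<nexists>f. packing_word 7 4 f"
  by (rule not_packing_word_if_not_extendable) code_simp

lemma not_packing_word_11_5: "\<nexists>f. packing_word 11 5 f"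
  by (rule not_packing_word_if_not_extendable) code_simp

lemma not_packing_word_15_6: "\<nexists>f. packing_word 15 6 f"
  by (rule not_packing_word_if_not_extendable) code_simp

section \<open>Explicit words\<close>

text \<open>Executable form of the gap condition in \<open>packing_word\<close>; the range of the
  letters is checked separately.\<close>

primrec packing_list :: "nat list \<Rightarrow> bool" where
  "packing_list [] \<longleftrightarrow> True"
| "packing_list (x # xs) \<longleftrightarrow> x \<notin> set (take (2 * x) xs) \<and> packing_list xs"

lemma packing_list_nth:
  assumes "packing_list xs" "i < j" "j < length xs" "xs ! i = xs ! j"
  shows "2 * xs ! i < j - i"
  using assms
proof (induction xs arbitrary: i j)
  case (Cons x xs)
  obtain j' where j': "j = Suc j'" "j' < length xs"
    using Cons.prems by (cases j) auto
  show ?case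
  proof (cases i)
    case 0
    have "xs ! j' \<in> set (take (2 * x) xs)" if "j' < 2 * x"
      using that j' by (auto simp: in_set_conv_nth intro!: exI[of _ j'])
    then have "\<not> j' < 2 * x"
      using Cons.prems j' 0 by auto
    then show ?thesis
      using j' 0 by simp
  next
    case (Suc i')
    then show ?thesis
      using Cons.IH[of i' j'] Cons.prems j' by simp
  qed
qed simp

lemma packing_word_nth:
  assumes "packing_list xs" "set xs \<subseteq> {1..k}" "length xs = L"
  shows "packing_word L k ((!) xs)"
  using assms nth_mem packing_list_nth unfolding packing_word_def by blast

text \<open>A violation in the periodic word has gap at most \<open>2 * k\<close>. Shifted by whole
  periods, it starts in the first copy of \<open>xs\<close> and ends within the list checked in the
  first assumption.\<close>

lemma packing_word_cyclic:
  assumes "packing_list (xs @ take (2 * k) xs)" "set xs \<subseteq> {1..k}" "xs \<noteq> []" "2 * k \<le> length xs"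
  shows "packing_word L k (\<lambda>i. xs ! (i mod length xs))"
  unfolding packing_word_def
proof (intro conjI allI impI)
  fix i
  have mem: "xs ! (i mod length xs) \<in> set xs" for i
    using assms(3) by simp
  then show "xs ! (i mod length xs) \<in> {1..k}"
    using assms(2) by blast
  fix j assume "i < j" and eq: "xs ! (i mod length xs) = xs ! (j mod length xs)"
  define ys where "ys = xs @ take (2 * k) xs"
  define r where "r = i mod length xs"
  have r: "r < length xs" using assms(3) by (simp add: r_def)
  show "2 * xs ! (i mod length xs) < j - i"
  proof (rule ccontr)
    assume neg: "\<not> ?thesis"
    moreover have "xs ! (i mod length xs) \<le> k"
      using mem[of i] assms(2) by auto
    ultimately have d: "j - i \<le> 2 * k" by linarith
    have "j mod length xs = (i + (j - i)) mod length xs"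
      using \<open>i < j\<close> by simp
    also have "\<dots> = (r + (j - i)) mod length xs"
      by (simp only: r_def mod_add_left_eq)
    finally have j: "j mod length xs = (r + (j - i)) mod length xs" .
    \<comment> \<open>As \<open>2 * k\<close> is at most the period, the index wraps around at most
      once and then falls into the appended prefix.\<close>
    have "ys ! (r + (j - i)) = xs ! (j mod length xs)"
    proof (cases "r + (j - i) < length xs")
      case False
      then have "(r + (j - i)) mod length xs = r + (j - i) - length xs"
        using r d assms(4) by (subst le_mod_geq) auto
      then show ?thesis
        using False j r d by (simp add: ys_def nth_append)
    qed (simp add: j ys_def nth_append)
    moreover have "ys ! r = xs ! r"
      using r by (simp add: ys_def nth_append)
    moreover have "r + (j - i) < length ys"
      using r d assms(4) by (simp add: ys_def)
    ultimately have "2 * ys ! r < r + (j - i) - r"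
      using packing_list_nth[of ys r "r + (j - i)"] assms(1) eq \<open>i < j\<close> by (simp add: ys_def r_def)
    with neg \<open>ys ! r = xs ! r\<close> show False by (simp add: r_def)
  qed
qed

text \<open>The lengths 5, 9, 13 and 17 belong to \<open>n\<close> = 3, 5, 7 and 9, the last path in
  each range; prefixes colour the shorter paths.\<close>

lemma packing_word_5_4: "packing_word 5 4 ((!) [1, 2, 3, 1, 4])"
  by (rule packing_word_nth) simp_all

lemma packing_word_9_5: "packing_word 9 5 ((!) [1, 3, 2, 1, 4, 5, 1, 2, 3])"
  by (rule packing_word_nth) simp_all

lemma packing_word_13_6: "packing_word 13 6 ((!) [1, 2, 3, 4, 1, 5, 2, 1, 6, 3, 1, 2, 4])"
  by (rule packing_word_nth) simp_all

lemma packing_word_17_7: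
  "packing_word 17 7 ((!) [1, 2, 3, 1, 4, 5, 1, 2, 6, 1, 3, 7, 1, 2, 4, 1, 5])"
  by (rule packing_word_nth) simp_all

text \<open>Found with a SAT solver.\<close>

definition cyclic_word :: "nat list" where
  "cyclic_word =
     [7, 1, 5, 4, 2, 1, 3, 8, 1, 2, 6, 1, 4, 3, 2, 1, 5, 7, 1, 2, 3, 4, 1, 6, 2, 1, 8,
      3, 1, 2, 4, 1, 7, 5, 1, 3, 2, 1, 6, 4, 1, 2, 3, 1, 8, 5, 1, 2, 4, 1, 3, 6, 1, 2]"

lemma packing_list_cyclic_word: "packing_list (cyclic_word @ take (2 * 8) cyclic_word)"
  by code_simp

text \<open>The period 54 is longer than the largest forbidden gap 16, so one cyclic word serves
  every \<open>L\<close>.\<close>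

lemma ex_packing_word_8: "\<exists>f. packing_word L 8 f"
proof
  show "packing_word L 8 (\<lambda>i. cyclic_word ! (i mod length cyclic_word))"
    by (rule packing_word_cyclic[OF packing_list_cyclic_word]) (simp_all add: cyclic_word_def)
qed

theorem theorem3p1:
  "packing_total_chromatic_number (path_graph 3) = 4 \<and>
   (\<forall>n\<in>{4, 5}. packing_total_chromatic_number (path_graph n) = 5) \<and>
   (\<forall>n\<in>{6, 7}. packing_total_chromatic_number (path_graph n) = 6) \<and>
   (\<forall>n\<in>{8, 9}. packing_total_chromatic_number (path_graph n) = 7) \<and>
   (\<forall>n\<ge>10. packing_total_chromatic_number (path_graph n) \<in> {7, 8})"
proof (intro conjI ballI allI impI)
  show "packing_total_chromatic_number (path_graph 3) = 4"
    using packing_total_chromatic_number_path_le[OF packing_word_5_4, of 3]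
      less_packing_total_chromatic_number_path[OF not_packing_word_5_3, of 3] by simp
next
  fix n :: nat assume "n \<in> {4, 5}"
  then show "packing_total_chromatic_number (path_graph n) = 5"
    using packing_total_chromatic_number_path_le[OF packing_word_9_5, of n]
      less_packing_total_chromatic_number_path[OF not_packing_word_7_4, of n] by auto
next
  fix n :: nat assume "n \<in> {6, 7}"
  then show "packing_total_chromatic_number (path_graph n) = 6"
    using packing_total_chromatic_number_path_le[OF packing_word_13_6, of n]
      less_packing_total_chromatic_number_path[OF not_packing_word_11_5, of n] by auto
next
  fix n :: nat assume "n \<in> {8, 9}"
  then show "packing_total_chromatic_number (path_graph n) = 7"
    using packing_total_chromatic_number_path_le[OF packing_word_17_7, of n]
      less_packing_total_chromatic_number_path[OF not_packing_word_15_6, of n] by auto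
next
  fix n :: nat assume "10 \<le> n"
  obtain f where "packing_word (2 * n - 1) 8 f"
    using ex_packing_word_8 by blast
  then have "packing_total_chromatic_number (path_graph n) \<le> 8"
    by (rule packing_total_chromatic_number_path_le) simp
  \<comment> \<open>Six colours already fail on the first 15 positions; whether 7 or 8 is attained
    stays open here.\<close>
  moreover have "6 < packing_total_chromatic_number (path_graph n)"
    using less_packing_total_chromatic_number_path[OF not_packing_word_15_6, of n] \<open>10 \<le> n\<close> by simp
  ultimately show "packing_total_chromatic_number (path_graph n) \<in> {7, 8}" by auto
qed

end
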